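(* Consider the conical ideal MHD system on the unit sphere in its quasilinear form $C^1\Phi_{\xi^1}+C^2\Phi_{\xi^2}+S^*=0$, with $\Phi=(\rho,v^1,v^2,V^3,P,b^1,b^2,B^3)^T$ and the $8\times8$ matrices $C^1,C^2$ given in the context, and treat $\xi^1$ as the time-like variable. At any state for which $C^1$ is invertible, four of the eight characteristic speeds, i.e. of the eigenvalues (counted with algebraic multiplicity) of $\bar C=(C^1)^{-1}C^2$, are $$\lambda=\frac{v^2}{v^1},\qquad \lambda=\frac{v^2}{v^1},\qquad \lambda=\frac{b^2+\sqrt{\mu\rho}\,v^2}{b^1+\sqrt{\mu\rho}\,v^1},\qquad \lambda=\frac{b^2-\sqrt{\mu\rho}\,v^2}{b^1-\sqrt{\mu\rho}\,v^1}.$$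
   Context: Here superscripts on $v,b$ are indices, not powers. $(g_{\alpha\beta})$, $\alpha,\beta\in\{1,2\}$, is the (symmetric positive definite) metric of the unit sphere in coordinates $(\xi^1,\xi^2)$, with inverse $(g^{\alpha\beta})$. The state variables are the density $\rho>0$, rescaled surface velocity components $v^1,v^2$, radial velocity $V^3$, pressure $P$, rescaled surface magnetic field components $b^1,b^2$, and radial magnetic field $B^3$; $\mu>0$ is the permeability constant. Write $b_\alpha=g_{\alpha\beta}b^\beta$ (summed over $\beta$). The speed of sound $c$ is $c=\sqrt{PP_e+\rho^2P_\rho}/\rho$, where $P=P(\rho,e)$ is the gas law in terms of density and specific thermal energy $e$ and subscripts denote partial derivatives. The system is the one obtained from the steady 3D ideal MHD equations with Powell source terms for conically invariant fields. In the variables $\Phi$ its matrices are $$C^1=\begin{pmatrix} v^1&\rho&0&0&0&0&0&0\\ 0&v^1&0&0&g^{11}/\rho&-g^{12}b_2/(\mu\rho)&g^{11}b_2/(\mu\rho)&g^{11}B^3/(\mu\rho)\\ 0&0&v^1&0&g^{12}/\rho&g^{12}b_1/(\mu\rho)&-g^{11}b_1/(\mu\rho)&g^{12}B^3/(\mu\rho)\\ 0&0&0&v^1&0&0&0&-b^1/(\mu\rho)\\ 0&c^2\rho&0&0&v^1&0&0&0\\ 0&0&0&0&0&v^1&0&0\\ 0&b^2&-b^1&0&0&0&v^1&0\\ 0&B^3&0&-b^1&0&0&0&v^1\end{pmatrix},$$ $$C^2=\begin{pmatrix} v^2&0&\rho&0&0&0&0&0\\ 0&v^2&0&0&g^{21}/\rho&-g^{22}b_2/(\mu\rho)&g^{12}b_2/(\mu\rho)&g^{21}B^3/(\mu\rho)\\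 0&0&v^2&0&g^{22}/\rho&g^{22}b_1/(\mu\rho)&-g^{12}b_1/(\mu\rho)&g^{22}B^3/(\mu\rho)\\ 0&0&0&v^2&0&0&0&-b^2/(\mu\rho)\\ 0&0&c^2\rho&0&v^2&0&0&0\\ 0&-b^2&b^1&0&0&v^2&0&0\\ 0&0&0&0&0&0&v^2&0\\ 0&0&B^3&-b^2&0&0&0&v^2\end{pmatrix}.$$ *)

theory Defs
  imports "HOL-Analysis.Analysis" "Jordan_Normal_Form.Char_Poly"
    "Jordan_Normal_Form.Gauss_Jordan_Elimination"
begin

text \<open>Components of elements of \<^typ>\<open>real^2\<close> are written with \<open>$\<close>; the entry \<open>x $ \<alpha>\<close> is the
  component with upper index \<open>\<alpha>\<close>.\<close>

no_notation vec_index (infixl \<open>$\<close> 100)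

record mhd_state =
  dens :: real
  vel :: "real^2"      \<comment> \<open>rescaled surface velocity \<open>(v\<^sup>1, v\<^sup>2)\<close>\<close>
  rvel :: real         \<comment> \<open>radial velocity \<open>V\<^sup>3\<close>\<close>
  pres :: real
  mag :: "real^2"      \<comment> \<open>rescaled surface magnetic field \<open>(b\<^sup>1, b\<^sup>2)\<close>\<close>
  rmag :: real         \<comment> \<open>radial magnetic field \<open>B\<^sup>3\<close>\<close>

definition coord_tangent :: "(real^2 \<Rightarrow> real^3) \<Rightarrow> 2 \<Rightarrow> real^2 \<Rightarrow> real^3" where
  "coord_tangent X \<alpha> \<xi> = frechet_derivative X (at \<xi>) (axis \<alpha> 1)"

definition sphere_coordinates :: "(real^2) set \<Rightarrow> (real^2 \<Rightarrow> real^3) \<Rightarrow> bool" where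
  "sphere_coordinates U X \<longleftrightarrow>
     open U \<and> inj_on X U \<and> X ` U \<subseteq> sphere 0 1 \<and>
     (\<forall>\<xi>\<in>U. X differentiable (at \<xi>)) \<and>
     (\<forall>\<alpha>. continuous_on U (coord_tangent X \<alpha>)) \<and>
     (\<forall>\<xi>\<in>U. inj (frechet_derivative X (at \<xi>)))"

definition sphere_metric :: "(real^2 \<Rightarrow> real^3) \<Rightarrow> real^2 \<Rightarrow> real^2^2" where
  "sphere_metric X \<xi> = (\<chi> \<alpha> \<beta>. coord_tangent X \<alpha> \<xi> \<bullet> coord_tangent X \<beta> \<xi>)"

text \<open>The gas law \<open>p\<close> gives the pressure \<open>p \<rho> e\<close> from density and specific thermal energy.\<close>

definition sound_radicand :: "(real \<Rightarrow> real \<Rightarrow> real) \<Rightarrow> real \<Rightarrow> real \<Rightarrow> real" where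
  "sound_radicand p \<rho> e = p \<rho> e * deriv (\<lambda>y. p \<rho> y) e + \<rho>\<^sup>2 * deriv (\<lambda>r. p r e) \<rho>"

definition sound_speed :: "(real \<Rightarrow> real \<Rightarrow> real) \<Rightarrow> real \<Rightarrow> real \<Rightarrow> real" where
  "sound_speed p \<rho> e = sqrt (sound_radicand p \<rho> e) / \<rho>"

text \<open>Coefficient matrices of \<open>\<Phi>\<^bsub>\<xi>\<^sup>1\<^esub>\<close> and \<open>\<Phi>\<^bsub>\<xi>\<^sup>2\<^esub>\<close> for the ordering
  \<open>\<Phi> = (\<rho>, v\<^sup>1, v\<^sup>2, V\<^sup>3, P, b\<^sup>1, b\<^sup>2, B\<^sup>3)\<close>, with permeability \<open>\<mu>\<close>, metric \<open>g\<close> (lower indices) and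
  sound speed \<open>c\<close>. Below, \<open>h\<close> is the inverse metric and \<open>bl\<close> is \<open>b\<close> with lowered index.\<close>

definition conical_C1 :: "real \<Rightarrow> real^2^2 \<Rightarrow> real \<Rightarrow> mhd_state \<Rightarrow> real mat" where
  "conical_C1 \<mu> g c \<Phi> =
    (let \<rho> = dens \<Phi>; v = vel \<Phi>; b = mag \<Phi>; B3 = rmag \<Phi>; h = matrix_inv g; bl = g *v b in
     mat_of_rows_list 8
      [[v$1, \<rho>, 0, 0, 0, 0, 0, 0],
       [0, v$1, 0, 0, h$1$1 / \<rho>, - (h$1$2 * bl$2) / (\<mu> * \<rho>), h$1$1 * bl$2 / (\<mu> * \<rho>), h$1$1 * B3 / (\<mu> * \<rho>)],
       [0, 0, v$1, 0, h$1$2 / \<rho>, h$1$2 * bl$1 / (\<mu> * \<rho>), - (h$1$1 * bl$1) / (\<mu> * \<rho>), h$1$2 * B3 / (\<mu> * \<rho>)],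
       [0, 0, 0, v$1, 0, 0, 0, - (b$1) / (\<mu> * \<rho>)],
       [0, c\<^sup>2 * \<rho>, 0, 0, v$1, 0, 0, 0],
       [0, 0, 0, 0, 0, v$1, 0, 0],
       [0, b$2, - (b$1), 0, 0, 0, v$1, 0],
       [0, B3, 0, - (b$1), 0, 0, 0, v$1]])"

definition conical_C2 :: "real \<Rightarrow> real^2^2 \<Rightarrow> real \<Rightarrow> mhd_state \<Rightarrow> real mat" where
  "conical_C2 \<mu> g c \<Phi> =
    (let \<rho> = dens \<Phi>; v = vel \<Phi>; b = mag \<Phi>; B3 = rmag \<Phi>; h = matrix_inv g; bl = g *v b in
     mat_of_rows_list 8
      [[v$2, 0, \<rho>, 0, 0, 0, 0, 0],
       [0, v$2, 0, 0, h$2$1 / \<rho>, - (h$2$2 * bl$2) / (\<mu> * \<rho>), h$1$2 * bl$2 / (\<mu> * \<rho>), h$2$1 * B3 / (\<mu> * \<rho>)],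
       [0, 0, v$2, 0, h$2$2 / \<rho>, h$2$2 * bl$1 / (\<mu> * \<rho>), - (h$1$2 * bl$1) / (\<mu> * \<rho>), h$2$2 * B3 / (\<mu> * \<rho>)],
       [0, 0, 0, v$2, 0, 0, 0, - (b$2) / (\<mu> * \<rho>)],
       [0, 0, c\<^sup>2 * \<rho>, 0, v$2, 0, 0, 0],
       [0, - (b$2), b$1, 0, 0, v$2, 0, 0],
       [0, 0, 0, 0, 0, 0, v$2, 0],
       [0, 0, B3, - (b$2), 0, 0, 0, v$2]])"

text \<open>Complex eigenvalues, repeated according to algebraic multiplicity.\<close>

definition eigenvalue_mset :: "real mat \<Rightarrow> complex multiset" where
  "eigenvalue_mset A = proots (char_poly (map_mat complex_of_real A))"

text \<open>Characteristic speeds of \<open>A \<Phi>\<^bsub>\<xi>\<^sup>1\<^esub> + B \<Phi>\<^bsub>\<xi>\<^sup>2\<^esub> + S = 0\<close> with \<open>\<xi>\<^sup>1\<close> time-like; meaningful only for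
  invertible \<open>A\<close>, where \<^const>\<open>mat_inverse\<close> returns the inverse.\<close>

definition characteristic_speeds :: "real mat \<Rightarrow> real mat \<Rightarrow> complex multiset" where
  "characteristic_speeds A B = eigenvalue_mset (the (mat_inverse A) * B)"

end

(* The characteristic polynomial of (C1)^-1 C2 is det (x C1 - C2) / det C1.  In the block splitting
   (rho, v1, v2, V3 | P, b1, b2, B3) the lower right block of s C1 + t C2 is the scalar matrix
   V = s v1 + t v2, so the 8x8 determinant collapses to that of a 4x4 matrix.  With
   beta = s b1 + t b2 the result is V^2 (V^2 - beta^2 / (mu rho)) times a quartic form (the
   magneto-acoustic modes).  At (s, t) = (x, -1) the first factor gives the double root and the two
   linear factors of the second give the remaining two; at (s, t) = (1, 0) the same factorization
   shows that invertibility of C1 makes all denominators nonzero. *)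

theory Submission
  imports Defs
begin

section \<open>Cofactor expansions and the determinant of the pencil\<close>

lemma det_dim_2:
  assumes "(A :: 'a :: comm_ring_1 mat) \<in> carrier_mat 2 2"
  shows "Determinant.det A = A $$ (0,0) * A $$ (1,1) - A $$ (0,1) * A $$ (1,0)"
proof -
  have c: "cofactor A i 0 = (-1) ^ i * A $$ (1 - i, 1)" if "i < 2" for i
  proof -
    have "mat_delete A i 0 \<in> carrier_mat 1 1"
      using mat_delete_carrier[of A 2 2 i 0] assms by simp
    then show ?thesis
      using assms that by (auto simp: cofactor_def det_single mat_delete_def)
  qed
  have "{..<2::nat} = {0, 1}" by auto
  then show ?thesis
    using c[of 0] c[of 1] by (simp add: laplace_expansion_column[OF assms, of 0] algebra_simps)
qed

lemma det_dim_3: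
  assumes "(A :: 'a :: comm_ring_1 mat) \<in> carrier_mat 3 3"
  shows "Determinant.det A =
      A $$ (0,0) * (A $$ (1,1) * A $$ (2,2) - A $$ (1,2) * A $$ (2,1))
    - A $$ (1,0) * (A $$ (0,1) * A $$ (2,2) - A $$ (0,2) * A $$ (2,1))
    + A $$ (2,0) * (A $$ (0,1) * A $$ (1,2) - A $$ (0,2) * A $$ (1,1))"
proof -
  have c: "mat_delete A i 0 \<in> carrier_mat 2 2" for i
    using mat_delete_carrier[of A 3 3 i 0] assms by simp
  have "{..<3::nat} = {0, 1, 2}" by auto
  then show ?thesis
    using assms
    unfolding laplace_expansion_column[OF assms, of 0, simplified] cofactor_def det_dim_2[OF c]
    by (simp add: mat_delete_def algebra_simps numeral_2_eq_2)
qed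

lemma det_first_column:
  assumes A: "(A :: 'a :: comm_ring_1 mat) \<in> carrier_mat (Suc n) (Suc n)"
    and zero: "\<And>i. 0 < i \<Longrightarrow> i \<le> n \<Longrightarrow> A $$ (i, 0) = 0"
  shows "Determinant.det A = A $$ (0,0) * Determinant.det (mat_delete A 0 0)"
proof -
  have "Determinant.det A = (\<Sum>i<Suc n. A $$ (i, 0) * cofactor A i 0)"
    by (rule laplace_expansion_column[OF A]) simp
  also have "\<dots> = A $$ (0,0) * cofactor A 0 0"
    using zero by (simp add: sum.lessThan_Suc_shift Suc_le_eq del: sum.lessThan_Suc)
  finally show ?thesis by (simp add: cofactor_def)
qed

text \<open>Here (\<open>n1\<close>, \<open>n2\<close>) is the covector (\<open>s\<close>,
  \<open>t\<close>) with its index raised, (\<open>c1\<close>, \<open>c2\<close>) is b with its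
  index lowered, \<open>a\<close> is the squared sound speed and \<open>m\<close> is 1 / (mu rho).
  All that the computation needs from the metric is \<open>dual\<close>: raising one index and
  lowering the other preserves the pairing.\<close>

lemma det_conical_pencil:
  fixes V \<rho> s t n1 n2 c1 c2 b1 b2 B m a :: real
  assumes \<rho>: "\<rho> \<noteq> 0"
    and dual: "n1 * c1 + n2 * c2 = s * b1 + t * b2"
  defines "\<beta> \<equiv> s * b1 + t * b2" and "N \<equiv> n1 * s + n2 * t"
  shows "Determinant.det (mat_of_rows_list 8
      [[V, \<rho> * s, \<rho> * t, 0, 0, 0, 0, 0],
       [0, V, 0, 0, n1 / \<rho>, - (n2 * c2 * m), n1 * c2 * m, n1 * B * m],
       [0, 0, V, 0, n2 / \<rho>, n2 * c1 * m, - (n1 * c1 * m), n2 * B * m],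
       [0, 0, 0, V, 0, 0, 0, - (\<beta> * m)],
       [0, a * \<rho> * s, a * \<rho> * t, 0, V, 0, 0, 0],
       [0, - (t * b2), t * b1, 0, 0, V, 0, 0],
       [0, s * b2, - (s * b1), 0, 0, 0, V, 0],
       [0, B * s, B * t, - \<beta>, 0, 0, 0, V]]) =
    V\<^sup>2 * (V\<^sup>2 - m * \<beta>\<^sup>2) *
      (V ^ 4 - (a + m * (b1 * c1 + b2 * c2 + B\<^sup>2)) * N * V\<^sup>2 + a * m * N * \<beta>\<^sup>2)"
    (is "Determinant.det ?M = _")
proof -
  define A where "A = mat_of_rows_list 4
    [[V, \<rho> * s, \<rho> * t, 0], [0, V, 0, 0], [0, 0, V, 0], [0, 0, 0, V]]"
  define E where "E = mat_of_rows_list 4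
    [[0, 0, 0, 0], [n1 / \<rho>, - (n2 * c2 * m), n1 * c2 * m, n1 * B * m],
     [n2 / \<rho>, n2 * c1 * m, - (n1 * c1 * m), n2 * B * m], [0, 0, 0, - (\<beta> * m)]]"
  define F where "F = mat_of_rows_list 4
    [[0, a * \<rho> * s, a * \<rho> * t, 0], [0, - (t * b2), t * b1, 0],
     [0, s * b2, - (s * b1), 0], [0, B * s, B * t, - \<beta>]]"
  define D where "D = V \<cdot>\<^sub>m (1\<^sub>m 4 :: real mat)"
  have carr: "A \<in> carrier_mat 4 4" "E \<in> carrier_mat 4 4" "F \<in> carrier_mat 4 4" "D \<in> carrier_mat 4 4"
    by (auto simp: A_def E_def F_def D_def mat_of_rows_list_def)
  have less4: "i < 4 \<longleftrightarrow> i = 0 \<or> i = 1 \<or> i = 2 \<or> i = 3" for i :: nat by auto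
  have less8: "i < 8 \<longleftrightarrow> i = 0 \<or> i = 1 \<or> i = 2 \<or> i = 3 \<or> i = 4 \<or> i = 5 \<or> i = 6 \<or> i = 7"
    for i :: nat by auto
  have blocks: "?M = four_block_mat A E F D"
    by (rule eq_matI) 
      (auto simp: less8 A_def E_def F_def D_def mat_of_rows_list_def)
  \<comment> \<open>Commutation with the scalar block \<open>D\<close> gives the block determinant
    formula for every \<open>V\<close>. A Schur complement would need \<open>V\<close> to be
    nonzero.\<close>
  have "F * D = D * F"
    unfolding D_def using carr(3)
    by (simp add: mult_smult_distrib[OF carr(3) one_carrier_mat]
        mult_smult_assoc_mat[OF one_carrier_mat carr(3)])
  then have "Determinant.det ?M = Determinant.det (A * D - E * F)"
    unfolding blocks using carr by (intro det_four_block_mat) auto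
  define S where "S = mat_of_rows_list 3
    [[V\<^sup>2 - a * n1 * s - m * N * c2 * b2 - m * B\<^sup>2 * n1 * s,
      - a * n1 * t + m * N * c2 * b1 - m * B\<^sup>2 * n1 * t, m * n1 * B * \<beta>],
     [- a * n2 * s + m * N * c1 * b2 - m * B\<^sup>2 * n2 * s,
      V\<^sup>2 - a * n2 * t - m * N * c1 * b1 - m * B\<^sup>2 * n2 * t, m * n2 * B * \<beta>],
     [m * \<beta> * B * s, m * \<beta> * B * t, V\<^sup>2 - m * \<beta>\<^sup>2]]"
  define G where "G = A * D - E * F"
  have G: "G \<in> carrier_mat (Suc 3) (Suc 3)" using carr by (auto simp: G_def)
  have Gij: "G $$ (i, j) = A $$ (i, j) * V - (\<Sum>k<4. E $$ (i, k) * F $$ (k, j))"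
    if "i < 4" "j < 4" for i j
  proof -
    have "(A * D) = V \<cdot>\<^sub>m A"
      unfolding D_def using carr(1) by (simp add: mult_smult_distrib[OF carr(1) one_carrier_mat])
    then show ?thesis
      using that carr by (simp add: G_def scalar_prod_def atLeast0LessThan mult.commute)
  qed
  have sum4: "(\<Sum>k<4. f k) = f 0 + f 1 + f 2 + f 3" for f :: "nat \<Rightarrow> real"
    by (simp add: eval_nat_numeral)
  \<comment> \<open>The first column of \<open>F\<close> is zero and that of \<open>A\<close> is
    \<open>V\<close> times the first unit vector, so the density variable splits off with a factor
    \<open>V\<close> squared and leaves the 3x3 matrix \<open>S\<close>.\<close>
  have G0: "G $$ (0, 0) = V\<^sup>2" "\<And>i. 0 < i \<Longrightarrow> i \<le> 3 \<Longrightarrow> G $$ (i, 0) = 0"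
    by (auto simp: Gij sum4 A_def E_def F_def mat_of_rows_list_def power2_eq_square
        dest!: le_imp_less_Suc simp: less4)
  have S: "mat_delete G 0 0 = S"
    by (rule eq_matI)
      (use G \<rho> in \<open>auto simp: mat_delete_def Gij sum4 A_def E_def F_def S_def mat_of_rows_list_def
         power2_eq_square less_Suc_eq numeral_3_eq_3 N_def algebra_simps\<close>)
  have "Determinant.det ?M = V\<^sup>2 * Determinant.det S"
    using \<open>Determinant.det ?M = Determinant.det (A * D - E * F)\<close> det_first_column[OF G G0(2)] G0(1) S
    by (simp add: G_def)
  also have "Determinant.det S = (V\<^sup>2 - m * \<beta>\<^sup>2) *
      (V ^ 4 - (a + m * (b1 * c1 + b2 * c2 + B\<^sup>2)) * N * V\<^sup>2 + a * m * N * \<beta>\<^sup>2)"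
  proof -
    define P where "P i j = S $$ (i, j)" for i j
    define w where "w = V\<^sup>2"
    \<comment> \<open>Lagrange's identity: the metric duality \<open>n \<bullet> c = k \<bullet> b\<close>, with \<open>k = (s, t)\<close>, makes \<open>L\<close> a square.\<close>
    define L where "L = N * (b1 * c1 + b2 * c2) - (s * c2 - t * c1) * (n1 * b2 - n2 * b1)"
    have "L = (n1 * c1 + n2 * c2) * (s * b1 + t * b2)"
      by (simp add: L_def N_def algebra_simps)
    then have L: "L = \<beta>\<^sup>2"
      by (simp add: dual \<beta>_def power2_eq_square)
    have S_carr: "S \<in> carrier_mat 3 3" by (auto simp: S_def mat_of_rows_list_def)
    have P3: "P 0 2 = m * n1 * B * \<beta>" "P 1 2 = m * n2 * B * \<beta>"
      "P 2 0 = m * \<beta> * B * s" "P 2 1 = m * \<beta> * B * t" "P 2 2 = w - m * \<beta>\<^sup>2"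
      by (simp_all add: P_def S_def w_def mat_of_rows_list_def)
    \<comment> \<open>With n, k = (\<open>s\<close>, \<open>t\<close>) and c, b rotated by a quarter
      turn, this 2x2 block is \<open>w\<close> times the identity minus two rank-one matrices:
      (\<open>a\<close> + m B^2) n k^T, from pressure and radial field, and m N c' b'^T, from the
      surface field, where c' = (\<open>c2\<close>, -\<open>c1\<close>) and b' = (\<open>b2\<close>,
      -\<open>b1\<close>).\<close>
    have P2: "P 0 0 = w - (a + m * B\<^sup>2) * n1 * s - m * N * c2 * b2"
      "P 0 1 = - (a + m * B\<^sup>2) * n1 * t + m * N * c2 * b1"
      "P 1 0 = - (a + m * B\<^sup>2) * n2 * s + m * N * c1 * b2"
      "P 1 1 = w - (a + m * B\<^sup>2) * n2 * t - m * N * c1 * b1"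
      by (simp_all add: P_def S_def w_def mat_of_rows_list_def algebra_simps)
    \<comment> \<open>Determinant of a bordered matrix: the last column is a multiple of n and the
      last row a multiple of k, so the correction to the product of the diagonal blocks is k^T
      adj(P) n.\<close>
    have "Determinant.det S = P 2 2 * (P 0 0 * P 1 1 - P 0 1 * P 1 0)
        - (m * B * \<beta>)\<^sup>2 * (s * (P 1 1 * n1 - P 0 1 * n2) + t * (P 0 0 * n2 - P 1 0 * n1))"
      unfolding det_dim_3[OF S_carr] P_def[symmetric] P3
      by (simp add: power2_eq_square algebra_simps)
    also have "P 0 0 * P 1 1 - P 0 1 * P 1 0 =
        w\<^sup>2 - w * N * (a + m * B\<^sup>2 + m * (b1 * c1 + b2 * c2)) + (a + m * B\<^sup>2) * m * N * L"
      unfolding P2 by (simp add: L_def N_def power2_eq_square algebra_simps)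
    also have "s * (P 1 1 * n1 - P 0 1 * n2) + t * (P 0 0 * n2 - P 1 0 * n1) = N * (w - m * L)"
      unfolding P2 by (simp add: L_def N_def power2_eq_square algebra_simps)
    \<comment> \<open>Once \<open>L\<close> is a square, w - m \<beta>^2 divides both terms, and the
      contributions of B^2 to the last coefficient of the quartic factor cancel.\<close>
    finally have "Determinant.det S =
        (w - m * \<beta>\<^sup>2) * (w\<^sup>2 - (a + m * (b1 * c1 + b2 * c2 + B\<^sup>2)) * N * w + a * m * N * \<beta>\<^sup>2)"
      unfolding P3 L by (simp add: power2_eq_square algebra_simps)
    then show ?thesis by (simp add: w_def flip: power_mult)
  qed
  finally show ?thesis by (simp add: mult.assoc)
qed

section \<open>Inverse matrices, characteristic polynomials and their roots\<close>

lemma matrix_inv_both: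
  fixes g :: "real^'n^'n"
  assumes "invertible g"
  shows "g ** matrix_inv g = Finite_Cartesian_Product.mat 1"
    "matrix_inv g ** g = Finite_Cartesian_Product.mat 1"
  using someI_ex[OF assms[unfolded invertible_def]] by (simp_all add: matrix_inv_def)

lemma matrix_inv_symmetric:
  fixes g :: "real^'n^'n"
  assumes "invertible g" "Finite_Cartesian_Product.transpose g = g"
  shows "Finite_Cartesian_Product.transpose (matrix_inv g) = matrix_inv g"
proof -
  let ?h = "matrix_inv g" and ?T = "Finite_Cartesian_Product.transpose :: real^'n^'n \<Rightarrow> real^'n^'n"
  have "?T ?h ** g = Finite_Cartesian_Product.mat 1"
    using arg_cong[OF matrix_inv_both(1)[OF assms(1)], of ?T] assms(2)
    by (simp add: matrix_transpose_mul transpose_mat)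
  then have "?T ?h ** (g ** ?h) = ?h"
    by (simp add: matrix_mul_assoc)
  then show ?thesis
    by (simp add: matrix_inv_both(1)[OF assms(1)])
qed

text \<open>From A M = B follows A (x 1 - M) = x A - B, and determinants multiply. This replaces the
  inverse of \<open>A\<close> by a pencil whose entries are explicit.\<close>

lemma det_inverse_mult_char:
  fixes A B :: "real mat"
  assumes A: "A \<in> carrier_mat n n" and B: "B \<in> carrier_mat n n" and inv: "invertible_mat A"
  defines "M \<equiv> the (mat_inverse A) * B"
  shows "M \<in> carrier_mat n n" "Determinant.det A \<noteq> 0"
    "Determinant.det A * poly (char_poly M) x = Determinant.det (x \<cdot>\<^sub>m A + (-1) \<cdot>\<^sub>m B)"
proof -
  obtain A' where A': "A * A' = 1\<^sub>m n" "A' * A = 1\<^sub>m (dim_row A')"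
    using inv A unfolding invertible_mat_def inverts_mat_def by auto
  have "dim_col A' = n" "dim_row A' = n"
    using arg_cong[OF A'(1), of dim_col] arg_cong[OF A'(2), of dim_col] A by auto
  then have "A' \<in> carrier_mat n n" by auto
  then have "Determinant.det A * Determinant.det A' = 1"
    using det_mult[OF A, of A'] A'(1) by simp
  then show d: "Determinant.det A \<noteq> 0" by auto
  \<comment> \<open>\<open>mat_inverse\<close> yields \<open>None\<close> only outside the units of
    the matrix ring, and a nonzero determinant makes \<open>A\<close> a unit. The argument
    \<open>()\<close> fills a dummy parameter of that ring structure.\<close>
  then obtain C where C: "mat_inverse A = Some C"
    using mat_inverse(1)[OF A, of "()"] det_non_zero_imp_unit[OF A d, of "()"]
    by (cases "mat_inverse A") auto
  have AC: "A * C = 1\<^sub>m n" and C': "C \<in> carrier_mat n n"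
    using mat_inverse(2)[OF A C] by auto
  have M: "M = C * B" by (simp add: M_def C)
  show Mc: "M \<in> carrier_mat n n" using M C' B by simp
  have AM: "A * M = B"
    unfolding M using assoc_mult_mat[OF A C' B] AC B by simp
  have "- char_matrix M x = x \<cdot>\<^sub>m 1\<^sub>m n + (-1) \<cdot>\<^sub>m M"
    using Mc by (intro eq_matI) (auto simp: char_matrix_def)
  then have "A * (- char_matrix M x) = A * (x \<cdot>\<^sub>m 1\<^sub>m n) + A * ((-1) \<cdot>\<^sub>m M)"
    using A Mc by (simp add: mult_add_distrib_mat[where n=n and nc=n])
  also have "\<dots> = x \<cdot>\<^sub>m A + (-1) \<cdot>\<^sub>m B"
    using A AM by (simp add: mult_smult_distrib[OF A one_carrier_mat] mult_smult_distrib[OF A Mc])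
  finally show "Determinant.det A * poly (char_poly M) x = Determinant.det (x \<cdot>\<^sub>m A + (-1) \<cdot>\<^sub>m B)"
    using det_mult[OF A, of "- char_matrix M x"] Mc by (simp add: char_poly_matrix[OF Mc])
qed

lemma poly_eqI_pointwise:
  fixes p q :: "'a :: {idom, ring_char_0} poly"
  assumes "\<And>x. poly p x = poly q x"
  shows "p = q"
  using assms by (simp add: poly_eq_poly_eq_iff[symmetric] fun_eq_iff)

text \<open>Over the complex numbers the root multiset of a product of nonzero polynomials is the
  sum of the root multisets. The cofactor \<open>q\<close> may have nonreal roots; they only enlarge
  the right-hand side.\<close>

lemma eigenvalue_mset_superset:
  fixes M :: "real mat"
  assumes M: "M \<in> carrier_mat n n"
    and fact: "char_poly M = (\<Prod>x\<in>#S. [:- x, 1:]) * q"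
  shows "image_mset complex_of_real S \<subseteq># eigenvalue_mset M"
proof -
  \<comment> \<open>A characteristic polynomial is monic, so the cofactor \<open>q\<close> is
    nonzero, as additivity of \<open>proots\<close> over products requires.\<close>
  have "char_poly M \<noteq> 0"
    using degree_monic_char_poly[OF M] by auto
  then have q: "q \<noteq> 0" using fact by auto
  interpret of_real_hom: comm_ring_hom complex_of_real
    by unfold_locales auto
  interpret of_real_poly: map_poly_comm_ring_hom complex_of_real ..
  have "char_poly (map_mat complex_of_real M) = map_poly complex_of_real (char_poly M)"
    by (rule of_real_hom.char_poly_hom[OF M])
  also have "\<dots> = (\<Prod>x\<in>#image_mset complex_of_real S. [:- x, 1:]) * map_poly complex_of_real q"
    unfolding fact of_real_poly.hom_mult
    by (simp add: of_real_poly.hom_prod_mset image_mset.compositionality comp_def)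
  finally have *: "char_poly (map_mat complex_of_real M) = \<dots>" .
  have nz: "map_poly complex_of_real q \<noteq> 0" using q by (simp add: map_poly_eq_0_iff)
  have nz': "(\<Prod>x\<in>#T. [:- x, 1:]) \<noteq> (0 :: complex poly)" for T by (auto simp: prod_mset_zero_iff)
  have pr: "proots (\<Prod>x\<in>#T. [:- x, 1:]) = T" for T :: "complex multiset"
    by (induction T) (simp_all add: proots_mult[OF _ nz'] del: mult_pCons_left mult_pCons_right)
  show ?thesis
    unfolding eigenvalue_mset_def * proots_mult[OF nz' nz] pr by simp
qed

section \<open>The sphere metric and the determinant in geometric variables\<close>

lemma sphere_metric_symmetric:
  "Finite_Cartesian_Product.transpose (sphere_metric X \<xi>) = sphere_metric X \<xi>"
  by (simp add: sphere_metric_def Finite_Cartesian_Product.transpose_def vec_eq_iff inner_commute)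

text \<open>The metric is the Gram matrix of the tangent vectors: its quadratic form at
  \<open>x\<close> is the squared length of the derivative of \<open>X\<close> applied to
  \<open>x\<close>. A kernel vector is thus killed by the derivative, which is injective.\<close>

lemma sphere_metric_invertible:
  assumes coords: "sphere_coordinates U X" and point: "\<xi> \<in> U"
  shows "invertible (sphere_metric X \<xi>)"
proof -
  let ?D = "frechet_derivative X (at \<xi>)"
  have "X differentiable (at \<xi>)" and inj: "inj ?D"
    using coords point by (auto simp: sphere_coordinates_def)
  then have lin: "linear ?D"
    using frechet_derivative_works has_derivative_linear by blast
  have "x = 0" if "sphere_metric X \<xi> *v x = 0" for x
  proof -
    have "?D x = ?D (\<Sum>i\<in>UNIV. x $ i *\<^sub>R axis i 1)"
      by (simp add: basis_expansion[of x, folded scalar_mult_eq_scaleR] flip: scalar_mult_eq_scaleR)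
    also have "\<dots> = (\<Sum>i\<in>UNIV. x $ i *\<^sub>R coord_tangent X i \<xi>)"
      by (simp add: linear_sum[OF lin] linear_cmul[OF lin] coord_tangent_def)
    finally have Dx: "?D x = (\<Sum>i\<in>UNIV. x $ i *\<^sub>R coord_tangent X i \<xi>)" .
    have inner_2: "inner x y = x $ 1 * y $ 1 + x $ 2 * y $ 2" for y
      by (simp add: inner_vec_def sum_2)
    have "inner (?D x) (?D x) = inner x (sphere_metric X \<xi> *v x)"
      unfolding Dx inner_2
      by (simp add: sum_2 matrix_vector_mult_def sphere_metric_def
          inner_add_left inner_add_right inner_commute algebra_simps)
    then have "?D x = ?D 0"
      using that linear_0[OF lin] by simp
    then show ?thesis using inj by (simp add: inj_eq)
  qed
  then show ?thesis
    by (auto simp: invertible_left_inverse matrix_left_invertible_ker)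
qed

lemma det_conical_combination:
  fixes \<mu> c s t :: real and g :: "real^2^2" and \<Phi> :: mhd_state
  assumes g: "invertible g" "Finite_Cartesian_Product.transpose g = g"
    and mu: "\<mu> > 0" and density: "dens \<Phi> > 0"
  defines "h \<equiv> matrix_inv g" and "b \<equiv> mag \<Phi>"
  defines "V \<equiv> s * vel \<Phi> $ 1 + t * vel \<Phi> $ 2"
    and "\<beta> \<equiv> s * b $ 1 + t * b $ 2"
    and "N \<equiv> s\<^sup>2 * h $ 1 $ 1 + 2 * s * t * h $ 1 $ 2 + t\<^sup>2 * h $ 2 $ 2"
    and "m \<equiv> 1 / (\<mu> * dens \<Phi>)"
  shows "Determinant.det (s \<cdot>\<^sub>m conical_C1 \<mu> g c \<Phi> + t \<cdot>\<^sub>m conical_C2 \<mu> g c \<Phi>) =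
    V\<^sup>2 * (V\<^sup>2 - m * \<beta>\<^sup>2) *
      (V ^ 4 - (c\<^sup>2 + m * (inner b (g *v b) + (rmag \<Phi>)\<^sup>2)) * N * V\<^sup>2 + c\<^sup>2 * m * N * \<beta>\<^sup>2)"
proof -
  define \<rho> where "\<rho> = dens \<Phi>"
  define c1 where "c1 = (g *v b) $ 1"
  define c2 where "c2 = (g *v b) $ 2"
  define n1 where "n1 = s * h $ 1 $ 1 + t * h $ 1 $ 2"
  define n2 where "n2 = s * h $ 1 $ 2 + t * h $ 2 $ 2"
  \<comment> \<open>Symmetry of the inverse metric lets the mixed entries of both matrices combine
    into the raised components \<open>n1\<close> and \<open>n2\<close>.\<close>
  have h21: "h $ 2 $ 1 = h $ 1 $ 2"
    using matrix_inv_symmetric[OF g]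
    by (metis (no_types) h_def Finite_Cartesian_Product.transpose_def vec_lambda_beta)
  have "h *v (g *v b) = b"
    by (simp add: matrix_vector_mul_assoc h_def matrix_inv_both[OF g(1)])
  then have "(h *v (g *v b)) $ 1 = b $ 1" "(h *v (g *v b)) $ 2 = b $ 2" by simp_all
  then have hc: "h $ 1 $ 1 * c1 + h $ 1 $ 2 * c2 = b $ 1" "h $ 1 $ 2 * c1 + h $ 2 $ 2 * c2 = b $ 2"
    unfolding c1_def c2_def matrix_vector_mult_def[of h] by (simp_all add: sum_2 h21)
  \<comment> \<open>With k = (\<open>s\<close>, \<open>t\<close>) this reads (h k) . (g b) = k . (h
    g b) = k . b.\<close>
  then have dual: "n1 * c1 + n2 * c2 = s * b $ 1 + t * b $ 2"
    by (simp add: n1_def n2_def algebra_simps flip: hc)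
  have less8: "i < 8 \<longleftrightarrow> i = 0 \<or> i = 1 \<or> i = 2 \<or> i = 3 \<or> i = 4 \<or> i = 5 \<or> i = 6 \<or> i = 7"
    for i :: nat by auto
  have pencil: "s \<cdot>\<^sub>m conical_C1 \<mu> g c \<Phi> + t \<cdot>\<^sub>m conical_C2 \<mu> g c \<Phi> = mat_of_rows_list 8
      [[V, \<rho> * s, \<rho> * t, 0, 0, 0, 0, 0],
       [0, V, 0, 0, n1 / \<rho>, - (n2 * c2 * m), n1 * c2 * m, n1 * rmag \<Phi> * m],
       [0, 0, V, 0, n2 / \<rho>, n2 * c1 * m, - (n1 * c1 * m), n2 * rmag \<Phi> * m],
       [0, 0, 0, V, 0, 0, 0, - ((s * b $ 1 + t * b $ 2) * m)],
       [0, c\<^sup>2 * \<rho> * s, c\<^sup>2 * \<rho> * t, 0, V, 0, 0, 0],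
       [0, - (t * b $ 2), t * b $ 1, 0, 0, V, 0, 0],
       [0, s * b $ 2, - (s * b $ 1), 0, 0, 0, V, 0],
       [0, rmag \<Phi> * s, rmag \<Phi> * t, - (s * b $ 1 + t * b $ 2), 0, 0, 0, V]]"
  proof (rule eq_matI, goal_cases)
    case (1 i j)
    then have "i < 8" "j < 8" by (simp_all add: mat_of_rows_list_def)
    with mu density show ?case
      unfolding less8
      by (elim disjE; simp add: conical_C1_def conical_C2_def Let_def mat_of_rows_list_def
        V_def \<rho>_def n1_def n2_def c1_def c2_def m_def h21 field_simps flip: h_def b_def)
  qed (simp_all add: conical_C1_def conical_C2_def Let_def mat_of_rows_list_def)
  have N: "N = n1 * s + n2 * t"
    by (simp add: N_def n1_def n2_def power2_eq_square algebra_simps)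
  have bb: "inner b (g *v b) = b $ 1 * c1 + b $ 2 * c2"
    by (simp add: inner_vec_def sum_2 c1_def c2_def)
  show ?thesis
    unfolding pencil N bb \<beta>_def
    by (rule det_conical_pencil) (use density dual \<rho>_def in auto)
qed

section \<open>Convective and Alfven speeds\<close>

theorem mainTheorem2:
  fixes U :: "(real^2) set" and X :: "real^2 \<Rightarrow> real^3" and \<xi> :: "real^2"
    and p :: "real \<Rightarrow> real \<Rightarrow> real" and e \<mu> :: real
    and \<Phi> :: mhd_state
  assumes coords: "sphere_coordinates U X" and point: "\<xi> \<in> U"
    and mu: "\<mu> > 0"
    and density: "dens \<Phi> > 0"
    and gas_law: "pres \<Phi> = p (dens \<Phi>) e"
    and gas_diff: "(\<lambda>r. p r e) differentiable (at (dens \<Phi>))" "(\<lambda>y. p (dens \<Phi>) y) differentiable (at e)"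
    and sound: "sound_radicand p (dens \<Phi>) e \<ge> 0"
    and inv: "invertible_mat (conical_C1 \<mu> (sphere_metric X \<xi>) (sound_speed p (dens \<Phi>) e) \<Phi>)"
  shows "vel \<Phi> $ 1 \<noteq> 0 \<and>
    mag \<Phi> $ 1 + sqrt (\<mu> * dens \<Phi>) * vel \<Phi> $ 1 \<noteq> 0 \<and>
    mag \<Phi> $ 1 - sqrt (\<mu> * dens \<Phi>) * vel \<Phi> $ 1 \<noteq> 0 \<and>
    image_mset complex_of_real
      {# vel \<Phi> $ 2 / vel \<Phi> $ 1,
         vel \<Phi> $ 2 / vel \<Phi> $ 1,
         (mag \<Phi> $ 2 + sqrt (\<mu> * dens \<Phi>) * vel \<Phi> $ 2) / (mag \<Phi> $ 1 + sqrt (\<mu> * dens \<Phi>) * vel \<Phi> $ 1),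
         (mag \<Phi> $ 2 - sqrt (\<mu> * dens \<Phi>) * vel \<Phi> $ 2) / (mag \<Phi> $ 1 - sqrt (\<mu> * dens \<Phi>) * vel \<Phi> $ 1) #}
    \<subseteq># characteristic_speeds
      (conical_C1 \<mu> (sphere_metric X \<xi>) (sound_speed p (dens \<Phi>) e) \<Phi>)
      (conical_C2 \<mu> (sphere_metric X \<xi>) (sound_speed p (dens \<Phi>) e) \<Phi>)"
proof -
  define g where "g = sphere_metric X \<xi>"
  define c where "c = sound_speed p (dens \<Phi>) e"
  define A where "A = conical_C1 \<mu> g c \<Phi>"
  define B where "B = conical_C2 \<mu> g c \<Phi>"
  define r where "r = sqrt (\<mu> * dens \<Phi>)"
  define m where "m = 1 / (\<mu> * dens \<Phi>)"
  define h where "h = matrix_inv g"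
  define K where "K = inner (mag \<Phi>) (g *v mag \<Phi>) + (rmag \<Phi>)\<^sup>2"
  let ?v1 = "vel \<Phi> $ 1" and ?v2 = "vel \<Phi> $ 2" and ?b1 = "mag \<Phi> $ 1" and ?b2 = "mag \<Phi> $ 2"
  have carr: "A \<in> carrier_mat 8 8" "B \<in> carrier_mat 8 8"
    by (auto simp: A_def B_def conical_C1_def conical_C2_def mat_of_rows_list_def Let_def)
  have r2: "r\<^sup>2 = \<mu> * dens \<Phi>" and "m \<noteq> 0" using mu density by (auto simp: r_def m_def)
  then have rm: "m * r\<^sup>2 = 1" using mu density by (simp add: m_def)
  \<comment> \<open>Since \<open>m\<close> is the inverse square of \<open>r\<close>, this is a
    difference of squares. With V for \<open>x\<close> and \<beta> for \<open>y\<close>, its two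
    linear factors carry the two Alfven speeds.\<close>
  have alfven: "x\<^sup>2 - m * y\<^sup>2 = - m * (y + r * x) * (y - r * x)" for x y :: real
    using rm by Groebner_Basis.algebra
  note det = det_conical_combination[OF sphere_metric_invertible[OF coords point]
      sphere_metric_symmetric mu density, folded g_def, folded h_def m_def K_def, where c = c, folded A_def B_def]
  have invA: "invertible_mat A" using inv by (simp add: A_def g_def c_def)
  note char = det_inverse_mult_char[OF carr invA]
  define M where "M = the (mat_inverse A) * B"
  have "1 \<cdot>\<^sub>m A + 0 \<cdot>\<^sub>m B = A"
    using carr by (intro eq_matI) auto
  then have "?v1 \<noteq> 0 \<and> ?v1\<^sup>2 - m * ?b1\<^sup>2 \<noteq> 0"
    using char(2) det[of 1 0] by auto
  then have v1: "?v1 \<noteq> 0" and bp: "?b1 + r * ?v1 \<noteq> 0" and bm: "?b1 - r * ?v1 \<noteq> 0"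
    by (auto simp: alfven)
  let ?S = "{# ?v2 / ?v1, ?v2 / ?v1, (?b2 + r * ?v2) / (?b1 + r * ?v1), (?b2 - r * ?v2) / (?b1 - r * ?v1) #}"
  \<comment> \<open>\<open>Vp\<close>, \<open>Bp\<close> and \<open>Np\<close> are V, \<beta> and N
    at (s, t) = (x, -1), as polynomials in x; \<open>q\<close> is the magneto-acoustic
    quartic.\<close>
  define Vp where "Vp = [:- ?v2, ?v1:]"
  define Bp where "Bp = [:- ?b2, ?b1:]"
  define Np where "Np = [:h $ 2 $ 2, - 2 * h $ 1 $ 2, h $ 1 $ 1:]"
  define q where "q = Vp ^ 4 - Polynomial.smult (c\<^sup>2 + m * K) (Np * Vp\<^sup>2)
    + Polynomial.smult (c\<^sup>2 * m) (Np * Bp\<^sup>2)"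
  \<comment> \<open>The reciprocal of the product of the leading coefficients of \<open>Vp\<close>
    (twice) and of \<open>Bp\<close> plus and minus \<open>r\<close> times \<open>Vp\<close>: it
    turns these four linear factors into the monic product \<open>R\<close>.\<close>
  define k where "k = 1 / ?v1 * (1 / ?v1 * (1 / (?b1 + r * ?v1) * (1 / (?b1 - r * ?v1))))"
  have "k \<noteq> 0" using v1 bp bm by (simp add: k_def)
  define R where "R = (\<Prod>x\<in>#?S. [:- x, 1:])"
  have S: "poly R y =
      k * (poly Vp y)\<^sup>2 * ((poly Bp y + r * poly Vp y) * (poly Bp y - r * poly Vp y))" for y
  proof -
    have lin: "y - u / w = 1 / w * (y * w - u)" if "w \<noteq> 0" for u w :: real
      using that by (simp add: field_simps)
    have "y - ?v2 / ?v1 = 1 / ?v1 * poly Vp y"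
      "y - (?b2 + r * ?v2) / (?b1 + r * ?v1) = 1 / (?b1 + r * ?v1) * (poly Bp y + r * poly Vp y)"
      "y - (?b2 - r * ?v2) / (?b1 - r * ?v1) = 1 / (?b1 - r * ?v1) * (poly Bp y - r * poly Vp y)"
      unfolding lin[OF v1] lin[OF bp] lin[OF bm] by (simp_all add: Vp_def Bp_def algebra_simps)
    moreover have "poly R y = (y - ?v2 / ?v1) * ((y - ?v2 / ?v1) *
        ((y - (?b2 + r * ?v2) / (?b1 + r * ?v1)) * (y - (?b2 - r * ?v2) / (?b1 - r * ?v1))))"
      by (simp add: R_def del: mult_pCons_left mult_pCons_right)
    ultimately show ?thesis
      by (simp only: k_def power2_eq_square mult_ac)
  qed
  \<comment> \<open>The scalar undoes three normalisations: -m comes from \<open>alfven\<close>, the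
    determinant of \<open>A\<close> from passing to the pencil, and \<open>k\<close> from making
    \<open>R\<close> monic.\<close>
  have "char_poly M = R * Polynomial.smult (- m / (Determinant.det A * k)) q"
  proof (rule poly_eqI_pointwise)
    fix x :: real
    have at_x: "x * ?v1 + - 1 * ?v2 = poly Vp x" "x * ?b1 + - 1 * ?b2 = poly Bp x"
      "x\<^sup>2 * h $ 1 $ 1 + 2 * x * - 1 * h $ 1 $ 2 + (- 1)\<^sup>2 * h $ 2 $ 2 = poly Np x"
      by (simp_all add: Vp_def Bp_def Np_def power2_eq_square algebra_simps)
    have "poly q x = poly Vp x ^ 4 - (c\<^sup>2 + m * K) * poly Np x * (poly Vp x)\<^sup>2
        + c\<^sup>2 * m * poly Np x * (poly Bp x)\<^sup>2"
      by (simp add: q_def mult.assoc)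
    then have "Determinant.det A * poly (char_poly M) x =
        (poly Vp x)\<^sup>2 * ((poly Vp x)\<^sup>2 - m * (poly Bp x)\<^sup>2) * poly q x"
      unfolding M_def char(3) det at_x by simp
    also have "\<dots> = - m / k * poly R x * poly q x"
      unfolding S alfven using \<open>k \<noteq> 0\<close> by simp
    finally show "poly (char_poly M) x =
        poly (R * Polynomial.smult (- m / (Determinant.det A * k)) q) x"
      unfolding poly_mult poly_smult using char(2) \<open>k \<noteq> 0\<close>
      by (simp add: field_simps)
  qed
  then have "image_mset complex_of_real ?S \<subseteq># eigenvalue_mset M"
    unfolding R_def by (rule eigenvalue_mset_superset[OF char(1)[folded M_def]])
  then show ?thesis
    using v1 bp bm unfolding characteristic_speeds_def M_def A_def B_def g_def c_def r_def by blast
qed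

end
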